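(* For each positive integer $v\equiv 15\pmod{18}$ there is a cyclic Steiner triple system of order $v$ that has chromatic index at least $\frac{v+3}{2}$.
   Context: A Steiner triple system of order $v$ is a pair $(V,\mathcal{B})$ where $V$ is a set of $v$ points and $\mathcal{B}$ is a collection of $3$-subsets of $V$ (triples) such that any two distinct points occur together in exactly one triple. It is cyclic if it has an automorphism (a permutation of $V$ mapping $\mathcal{B}$ onto $\mathcal{B}$) that permutes all $v$ points in a single cycle of length $v$. A partial parallel class is a set of pairwise disjoint triples of the system. The chromatic index of $(V,\mathcal{B})$ is the smallest number of partial parallel classes into which $\mathcal{B}$ can be partitioned. *)

theory Defs
  imports
    Complex_Main
    "HOL-Library.Disjoint_Sets"
    "HOL-Combinatorics.Permutations"
    "HOL-Combinatorics.Orbits"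
    "HOL-Number_Theory.Cong"
begin

definition steiner_triple_system :: "nat \<Rightarrow> 'a set \<Rightarrow> 'a set set \<Rightarrow> bool" where
  "steiner_triple_system v V \<B> \<longleftrightarrow>
     finite V \<and> card V = v \<and>
     (\<forall>T\<in>\<B>. T \<subseteq> V \<and> card T = 3) \<and>
     (\<forall>x\<in>V. \<forall>y\<in>V. x \<noteq> y \<longrightarrow> (\<exists>!T. T \<in> \<B> \<and> x \<in> T \<and> y \<in> T))"

definition sts_automorphism :: "'a set \<Rightarrow> 'a set set \<Rightarrow> ('a \<Rightarrow> 'a) \<Rightarrow> bool" where
  "sts_automorphism V \<B> \<pi> \<longleftrightarrow> \<pi> permutes V \<and> (\<lambda>T. \<pi> ` T) ` \<B> = \<B>"

text \<open>
  The condition \<^term>\<open>cyclic_on \<pi> V\<close> says that \<open>V\<close> is a single orbit of \<open>\<pi>\<close>; for a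
  permutation of \<open>V\<close> this is one cycle of length \<^term>\<open>card V\<close>.
\<close>

definition cyclic_steiner_triple_system :: "nat \<Rightarrow> 'a set \<Rightarrow> 'a set set \<Rightarrow> bool" where
  "cyclic_steiner_triple_system v V \<B> \<longleftrightarrow>
     steiner_triple_system v V \<B> \<and>
     (\<exists>\<pi>. sts_automorphism V \<B> \<pi> \<and> cyclic_on \<pi> V)"

definition partial_parallel_class :: "'a set set \<Rightarrow> 'a set set \<Rightarrow> bool" where
  "partial_parallel_class \<B> C \<longleftrightarrow> C \<subseteq> \<B> \<and> disjoint C"

text \<open>
  The minimum is meant for finite \<open>\<B>\<close>, where the partition into singletons shows that it
  is taken over a nonempty set of numbers.
\<close>

definition chromatic_index :: "'a set set \<Rightarrow> nat" where
  "chromatic_index \<B> =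
     (LEAST k. \<exists>P. partition_on \<B> P \<and> finite P \<and> card P = k \<and>
                   (\<forall>C\<in>P. partial_parallel_class \<B> C))"

end

theory Submission
  imports Defs
begin

text \<open>
  Write \<open>v = 3n\<close>; then \<open>n\<close> is odd and \<open>n \<equiv> 2 (mod 3)\<close>. The system is Bose's: the points are
  the elements of \<open>\<int>\<^sub>n \<times> \<int>\<^sub>3\<close>, with the second coordinate called the layer, and the triples are
  the \<open>n\<close> vertical triples \<open>{(a, 0), (a, 1), (a, 2)}\<close> and the slanted triples
  \<open>{(a, i), (b, i), ((a + b) / 2, i + 1)}\<close> with \<open>a \<noteq> b\<close>. Translation by \<open>(1, 1)\<close> preserves it, and
  because \<open>n\<close> is coprime to \<open>3\<close> this translation is a single cycle. By the Chinese remainder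
  theorem a point can be stored as a number below \<open>3n\<close>, and the translation becomes adding \<open>1\<close>.

  Suppose that a parallel class has \<open>b\<close> vertical triples, and \<open>a\<^sub>i\<close> slanted ones with two
  points in layer \<open>i\<close>. Counting the points of layer \<open>i\<close> gives \<open>n = b + 2a\<^sub>i + a\<^sub>i\<^sub>-\<^sub>1\<close> for all three \<open>i\<close>,
  which forces the \<open>a\<^sub>i\<close> to be equal, so \<open>b \<equiv> n \<equiv> 2 (mod 3)\<close> and \<open>b \<ge> 2\<close>
  (\<open>parallel_class_two_verticals\<close>). Parallel classes are therefore expensive: only \<open>n\<close>
  vertical triples exist, so fewer than \<open>n/2\<close> disjoint classes can have the full size \<open>n\<close>, and all others
  have size at most \<open>n - 1\<close>. Covering all \<open>n(3n - 1)/2\<close> triples then takes more than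
  \<open>(3n + 1)/2\<close> classes (\<open>chromatic_index_lower_bound\<close>), and since \<open>3n + 1\<close> is even this is the bound.
\<close>

section \<open>Steiner triple systems and partial parallel classes\<close>

text \<open>
  Every \<open>2\<close>-subset of the points lies in exactly one triple and every triple contains three of them.
\<close>

lemma card_triples_of_steiner_triple_system:
  assumes "steiner_triple_system v V \<B>"
  shows "finite \<B>" and "6 * card \<B> = v * (v - 1)"
proof -
  let ?pairs = "\<lambda>T. {S. S \<subseteq> T \<and> card S = 2}"
  have fV: "finite V" and cV: "card V = v"
    using assms by (auto simp: steiner_triple_system_def)
  have tri: "T \<subseteq> V" "card T = 3" "finite T" if "T \<in> \<B>" for T
    using assms that by (auto simp: steiner_triple_system_def intro: finite_subset)
  have pair: "\<exists>!T. T \<in> \<B> \<and> x \<in> T \<and> y \<in> T" if "x \<in> V" "y \<in> V" "x \<noteq> y" for x y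
    using assms that by (auto simp: steiner_triple_system_def)
  show fB: "finite \<B>"
    using tri(1) fV by (intro finite_subset[of \<B> "Pow V"]) auto
  have union: "?pairs V = (\<Union>T\<in>\<B>. ?pairs T)"
  proof (intro subset_antisym subsetI)
    fix S assume "S \<in> ?pairs V"
    then obtain x y where "S = {x, y}" "x \<noteq> y" "x \<in> V" "y \<in> V"
      by (auto simp: card_2_iff)
    with pair[of x y] show "S \<in> (\<Union>T\<in>\<B>. ?pairs T)"
      by auto
  qed (use tri(1) in blast)
  have disj: "?pairs T \<inter> ?pairs T' = {}" if "T \<in> \<B>" "T' \<in> \<B>" "T \<noteq> T'" for T T'
  proof (rule ccontr)
    assume "?pairs T \<inter> ?pairs T' \<noteq> {}"
    then obtain x y where "x \<noteq> y" "{x, y} \<subseteq> T" "{x, y} \<subseteq> T'"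
      by (auto simp: card_2_iff)
    with pair[of x y] that tri(1)[OF that(1)] show False
      by auto
  qed
  have "v choose 2 = card (?pairs V)"
    using n_subsets[OF fV] cV by simp
  also have "\<dots> = (\<Sum>T\<in>\<B>. card (?pairs T))"
    unfolding union
    by (rule card_UN_disjoint) (use fB tri(3) disj in auto)
  also have "\<dots> = (\<Sum>T\<in>\<B>. 3)"
    using n_subsets[OF tri(3)] tri(2) by (intro sum.cong) (auto simp: numeral_eq_Suc)
  finally have "v choose 2 = 3 * card \<B>"
    by simp
  moreover have "2 * (v choose 2) = v * (v - 1)"
    using dvd_mult_div_cancel[of 2 "v * (v - 1)"] by (cases v) (auto simp: choose_two)
  ultimately show "6 * card \<B> = v * (v - 1)"
    by simp
qed

lemma card_Union_partial_parallel_class: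
  assumes "steiner_triple_system v V \<B>" and "partial_parallel_class \<B> C"
  shows "card (\<Union>C) = 3 * card C"
proof -
  have tri: "card T = 3" if "T \<in> C" for T
    using assms that by (auto simp: steiner_triple_system_def partial_parallel_class_def)
  have "card (\<Union>C) = (\<Sum>T\<in>C. card T)"
    using assms(2) tri
    by (intro card_Union_disjoint)
      (auto simp: partial_parallel_class_def intro: card_ge_0_finite)
  also have "\<dots> = 3 * card C"
    using tri by simp
  finally show ?thesis .
qed

lemma card_partial_parallel_class_le:
  assumes "steiner_triple_system (3 * n) V \<B>" and "partial_parallel_class \<B> C"
  shows "card C \<le> n" and "card C = n \<Longrightarrow> \<Union>C = V"
proof -
  have sub: "\<Union>C \<subseteq> V" and fin: "finite V" and card: "card V = 3 * n"
    using assms by (auto simp: steiner_triple_system_def partial_parallel_class_def)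
  show "card C \<le> n"
    using card_mono[OF fin sub] card card_Union_partial_parallel_class[OF assms] by simp
  show "\<Union>C = V" if "card C = n"
    using card_subset_eq[OF fin sub] that card card_Union_partial_parallel_class[OF assms] by simp
qed

text \<open>
  The partition into singletons makes the set of numbers being minimised nonempty, so its least
  element is realised by a partition.
\<close>

lemma chromatic_index_attained:
  assumes "finite \<B>"
  obtains P where "partition_on \<B> P" "finite P" "card P = chromatic_index \<B>"
    "\<And>C. C \<in> P \<Longrightarrow> partial_parallel_class \<B> C"
proof -
  let ?Q = "\<lambda>k. \<exists>P. partition_on \<B> P \<and> finite P \<and> card P = k \<and>
                   (\<forall>C\<in>P. partial_parallel_class \<B> C)"
  have "partition_on \<B> ((\<lambda>T. {T}) ` \<B>)"
    by (auto simp: partition_on_def disjoint_def)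
  moreover have "\<forall>C\<in>(\<lambda>T. {T}) ` \<B>. partial_parallel_class \<B> C"
    by (auto simp: partial_parallel_class_def)
  ultimately have "?Q (card ((\<lambda>T. {T}) ` \<B>))"
    using assms by blast
  then have "?Q (chromatic_index \<B>)"
    unfolding chromatic_index_def by (rule LeastI)
  then show thesis
    using that by blast
qed

text \<open>
  A set \<open>W\<close> of at most \<open>n\<close> triples that every parallel class meets twice limits the number of
  parallel classes. The two kinds of classes are treated at once: a partial parallel class \<open>C\<close>
  satisfies \<open>2|C| \<le> 2(n - 1) + |C \<inter> W|\<close>, either because \<open>|C| \<le> n - 1\<close> or because \<open>|C| = n\<close> and
  \<open>|C \<inter> W| \<ge> 2\<close>. Summing over \<open>k\<close> classes gives \<open>n(3n - 1) \<le> 2(n - 1)k + n\<close>, which fails for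
  \<open>2k \<le> 3n + 1\<close>.
\<close>

lemma chromatic_index_lower_bound:
  assumes sts: "steiner_triple_system (3 * n) V \<B>" and "n > 0"
    and "W \<subseteq> \<B>" and "card W \<le> n"
    and two: "\<And>C. partial_parallel_class \<B> C \<Longrightarrow> \<Union>C = V \<Longrightarrow> 2 \<le> card (C \<inter> W)"
  shows "3 * n + 1 < 2 * chromatic_index \<B>"
proof (rule ccontr)
  assume "\<not> ?thesis"
  then have small: "2 * chromatic_index \<B> \<le> 3 * n + 1"
    by simp
  have fB: "finite \<B>" and cB: "6 * card \<B> = 3 * n * (3 * n - 1)"
    using card_triples_of_steiner_triple_system[OF sts] by auto
  obtain P where P: "partition_on \<B> P" "finite P" "card P = chromatic_index \<B>"
    "\<And>C. C \<in> P \<Longrightarrow> partial_parallel_class \<B> C"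
    by (rule chromatic_index_attained[OF fB]) blast
  have fin: "finite C" if "C \<in> P" for C
    using P(1) that fB by (auto simp: partition_on_def intro: finite_subset)
  have disj: "C \<inter> C' = {}" if "C \<in> P" "C' \<in> P" "C \<noteq> C'" for C C'
    using P(1) that by (auto simp: partition_on_def disjoint_def)
  have union: "\<Union>P = \<B>"
    using P(1) by (simp add: partition_on_def)
  have "2 * card C \<le> 2 * (n - 1) + card (C \<inter> W)" if "C \<in> P" for C
    using card_partial_parallel_class_le[OF sts P(4)[OF that]] two[OF P(4)[OF that]] \<open>n > 0\<close>
    by (cases "card C = n") auto
  then have "(\<Sum>C\<in>P. 2 * card C) \<le> (\<Sum>C\<in>P. 2 * (n - 1) + card (C \<inter> W))"
    by (rule sum_mono)
  also have "\<dots> = 2 * (n - 1) * card P + (\<Sum>C\<in>P. card (C \<inter> W))"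
    by (simp add: sum.distrib)
  also have "(\<Sum>C\<in>P. card (C \<inter> W)) = card (\<Union>C\<in>P. C \<inter> W)"
    by (rule card_UN_disjoint[symmetric]) (use P(2) fin disj in auto)
  also have "(\<Union>C\<in>P. C \<inter> W) = W"
    using union \<open>W \<subseteq> \<B>\<close> by blast
  also have "(\<Sum>C\<in>P. 2 * card C) = 2 * card \<B>"
    using card_UN_disjoint[of P "\<lambda>C. C"] P(2) fin disj union by (simp add: sum_distrib_left)
  finally have "2 * card \<B> \<le> (n - 1) * (2 * chromatic_index \<B>) + n"
    using P(3) \<open>card W \<le> n\<close> by (simp add: mult_ac)
  also have "\<dots> \<le> (n - 1) * (3 * n + 1) + n"
    using small by (intro add_right_mono mult_left_mono) auto
  finally have "2 * card \<B> \<le> (n - 1) * (3 * n + 1) + n" .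
  moreover obtain m where "n = Suc m"
    using \<open>n > 0\<close> gr0_implies_Suc by blast
  ultimately show False
    using cB by (simp add: algebra_simps)
qed

text \<open>
  It is enough to give the third point on each line as a totally symmetric relation; then no triple
  has to be inspected for which of its points are the two given ones.
\<close>

lemma steiner_triple_system_of_collinearity:
  assumes "finite V" and "card V = v"
    and points: "\<And>x y z. col x y z \<Longrightarrow> x \<in> V \<and> y \<in> V \<and> z \<in> V"
    and distinct: "\<And>x y z. col x y z \<Longrightarrow> x \<noteq> y \<and> y \<noteq> z \<and> x \<noteq> z"
    and swap: "\<And>x y z. col x y z \<Longrightarrow> col y x z"
    and rot: "\<And>x y z. col x y z \<Longrightarrow> col y z x"
    and ex1: "\<And>x y. x \<in> V \<Longrightarrow> y \<in> V \<Longrightarrow> x \<noteq> y \<Longrightarrow> \<exists>!z. col x y z"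
  shows "steiner_triple_system v V {{x, y, z} | x y z. col x y z}" (is "steiner_triple_system _ _ ?\<B>")
  unfolding steiner_triple_system_def
proof (intro conjI ballI impI)
  fix T assume "T \<in> ?\<B>"
  then obtain x y z where "T = {x, y, z}" "col x y z"
    by blast
  with points distinct show "T \<subseteq> V" "card T = 3"
    by auto
next
  fix x y assume xy: "x \<in> V" "y \<in> V" "x \<noteq> y"
  from ex1[OF this] obtain z where z: "col x y z" and unique: "\<And>z'. col x y z' \<Longrightarrow> z' = z"
    by blast
  have "T = {x, y, z}" if T: "T \<in> ?\<B>" "x \<in> T" "y \<in> T" for T
  proof -
    from T(1) obtain a b c where abc: "T = {a, b, c}" "col a b c"
      by blast
    obtain z' where "col x y z'" "T = {x, y, z'}"
      using T(2,3) abc \<open>x \<noteq> y\<close> swap rot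
      by (smt (verit) insert_commute insert_iff singletonD)
    with unique show ?thesis
      by blast
  qed
  with z show "\<exists>!T. T \<in> ?\<B> \<and> x \<in> T \<and> y \<in> T"
    by (intro ex1I[of _ "{x, y, z}"]) blast+
qed (fact assms(1,2))+

section \<open>The cyclic Bose system\<close>

locale bose =
  fixes n :: nat
  assumes n_mod_6: "n mod 6 = 5"
begin

text \<open>
  The number \<open>x < 3n\<close> stands for the point with first coordinate \<open>x mod n\<close> and layer \<open>x mod 3\<close>.
\<close>

definition vertical :: "nat \<Rightarrow> nat \<Rightarrow> nat \<Rightarrow> bool" where
  "vertical x y z \<longleftrightarrow> x < 3 * n \<and> y < 3 * n \<and> z < 3 * n \<and>
     x mod 3 \<noteq> y mod 3 \<and> y mod 3 \<noteq> z mod 3 \<and> x mod 3 \<noteq> z mod 3 \<and>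
     [x = y] (mod n) \<and> [y = z] (mod n)"

text \<open>
  The last argument is the midpoint of the other two, one layer further on; the relation is
  symmetric in its first two arguments only.
\<close>

definition slanted :: "nat \<Rightarrow> nat \<Rightarrow> nat \<Rightarrow> bool" where
  "slanted x y z \<longleftrightarrow> x < 3 * n \<and> y < 3 * n \<and> z < 3 * n \<and> x \<noteq> y \<and>
     y mod 3 = x mod 3 \<and> z mod 3 = (x + 1) mod 3 \<and> [x + y = 2 * z] (mod n)"

definition collinear :: "nat \<Rightarrow> nat \<Rightarrow> nat \<Rightarrow> bool" where
  "collinear x y z \<longleftrightarrow> vertical x y z \<or> slanted x y z \<or> slanted y z x \<or> slanted z x y"

definition triples :: "nat set set" where
  "triples = {{x, y, z} | x y z. collinear x y z}"

definition vertical_triples :: "nat set set" where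
  "vertical_triples = {{x, y, z} | x y z. vertical x y z}"

text \<open>
  Points outside the system are fixed, as a permutation of a proper subset of a type must do.
\<close>

definition shift :: "nat \<Rightarrow> nat" where
  "shift x = (if x < 3 * n then (x + 1) mod (3 * n) else x)"

lemma n_pos: "n > 0" and n_mod_3: "n mod 3 = 2" and odd_n: "odd n"
  using n_mod_6 by presburger+

lemma coprime_3_n: "coprime 3 n"
proof -
  have "\<not> 3 dvd n" using n_mod_3 by presburger
  then show ?thesis by (simp add: prime_imp_coprime)
qed

lemma coprime_2_n: "coprime 2 n"
  using odd_n by simp

lemma halve_cong: "[x = y] (mod n)" if "[2 * x = 2 * y] (mod n)"
  using that cong_mult_lcancel_nat coprime_2_n by metis

lemma point_eqI:
  assumes "x < 3 * n" "y < 3 * n" "x mod 3 = y mod 3" "[x = y] (mod n)"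
  shows "x = y"
proof -
  have "[x = y] (mod 3 * n)"
    using coprime_cong_mult_nat[OF _ assms(4) coprime_3_n] assms(3) by (simp add: cong_def)
  then show ?thesis
    using assms(1,2) by (simp add: cong_def)
qed

lemma point_exists: "\<exists>x < 3 * n. x mod 3 = i mod 3 \<and> [x = a] (mod n)"
proof -
  obtain x where "[x = i] (mod 3)" "[x = a] (mod n)"
    using binary_chinese_remainder_nat[OF coprime_3_n] by blast
  then show ?thesis
    using n_pos by (intro exI[of _ "x mod (3 * n)"]) (auto simp: cong_def mod_mod_cancel)
qed

lemma collinear_points: "collinear x y z \<Longrightarrow> x < 3 * n \<and> y < 3 * n \<and> z < 3 * n"
  by (auto simp: collinear_def vertical_def slanted_def)

lemma vertical_layers:
  assumes "vertical x y z" and "i < 3"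
  shows "i = x mod 3 \<or> i = y mod 3 \<or> i = z mod 3"
proof -
  have "a < 3 \<Longrightarrow> b < 3 \<Longrightarrow> c < 3 \<Longrightarrow> a \<noteq> b \<Longrightarrow> b \<noteq> c \<Longrightarrow> a \<noteq> c \<Longrightarrow> i = a \<or> i = b \<or> i = c"
    for a b c :: nat
    using assms(2) by linarith
  from this[of "x mod 3" "y mod 3" "z mod 3"] show ?thesis
    using assms(1) by (simp add: vertical_def)
qed

lemma slanted_layers: "slanted x y z \<Longrightarrow> y mod 3 = x mod 3 \<and> z mod 3 = (x + 1) mod 3"
  by (simp add: slanted_def)

lemma mod_3_neq: "x mod 3 \<noteq> (x + 1) mod 3" for x :: nat
  by (simp add: mod_Suc)

lemma collinear_distinct:
  assumes "collinear x y z"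
  shows "x \<noteq> y \<and> y \<noteq> z \<and> x \<noteq> z"
  using assms mod_3_neq[of x] mod_3_neq[of y] mod_3_neq[of z]
  by (auto simp: collinear_def vertical_def slanted_def)

lemma slanted_swap:
  assumes "slanted x y z"
  shows "slanted y x z"
proof -
  have "(y + 1) mod 3 = (x + 1) mod 3"
    using assms unfolding slanted_def by (metis mod_add_left_eq)
  then show ?thesis
    using assms by (auto simp: slanted_def add.commute)
qed

lemma vertical_swap: "vertical x y z \<Longrightarrow> vertical y x z"
  and vertical_rot: "vertical x y z \<Longrightarrow> vertical y z x"
  by (auto simp: vertical_def cong_def)

lemma collinear_swap: "collinear x y z \<Longrightarrow> collinear y x z"
  using slanted_swap vertical_swap unfolding collinear_def by blast

lemma collinear_rot: "collinear x y z \<Longrightarrow> collinear y z x"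
  using vertical_rot unfolding collinear_def by blast

text \<open>
  Two points of one layer can only lie on a slanted triple, as its two base points. Halving is
  possible modulo the odd number \<open>n\<close>, so their midpoint exists and is unique.
\<close>

lemma third_point_same_layer:
  assumes "x < 3 * n" "y < 3 * n" "x \<noteq> y" "y mod 3 = x mod 3"
  shows "\<exists>!z. collinear x y z"
proof -
  have only: "collinear x y z \<longleftrightarrow> slanted x y z" for z
  proof -
    have "\<not> slanted y z x" "\<not> slanted z x y"
      using assms(4) slanted_layers[of y z x] slanted_layers[of z x y] mod_3_neq[of y] mod_3_neq[of z] by auto
    then show ?thesis
      using assms(4) by (auto simp: collinear_def vertical_def)
  qed
  \<comment> \<open>\<open>h\<close> is the inverse of \<open>2\<close> modulo \<open>n\<close>.\<close>
  obtain h where h: "2 * h = n + 1"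
    using odd_n by (metis even_Suc evenE Suc_eq_plus1)
  obtain z where z: "z < 3 * n" "z mod 3 = (x + 1) mod 3" "[z = h * (x + y)] (mod n)"
    using point_exists by blast
  have "[2 * z = 2 * (h * (x + y))] (mod n)"
    using z(3) by (rule cong_scalar_left)
  also have "2 * (h * (x + y)) = (x + y) + n * (x + y)"
    using h by (metis add_mult_distrib mult.assoc mult_1 add.commute)
  also have "[\<dots> = x + y] (mod n)"
    by (simp add: cong_def)
  finally have "[x + y = 2 * z] (mod n)"
    by (rule cong_sym)
  then have "slanted x y z"
    using assms z by (simp add: slanted_def)
  moreover have "z' = z" if "slanted x y z'" for z'
  proof (rule point_eqI)
    show "[z' = z] (mod n)"
      by (rule halve_cong) (use that \<open>slanted x y z\<close> in \<open>simp add: slanted_def cong_def\<close>)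
  qed (use that z in \<open>auto simp: slanted_def\<close>)
  ultimately show ?thesis
    using only by blast
qed

text \<open>
  If the two points have the same first coordinate they lie on a vertical triple; a slanted triple
  through them would have both base points equal. Otherwise \<open>y\<close> is the midpoint of \<open>x\<close> and the
  reflection of \<open>x\<close> in \<open>y\<close>.
\<close>

lemma third_point_next_layer:
  assumes "x < 3 * n" "y < 3 * n" "y mod 3 = (x + 1) mod 3"
  shows "\<exists>!z. collinear x y z"
proof -
  have only: "collinear x y z \<longleftrightarrow> vertical x y z \<or> slanted z x y" for z
  proof -
    have "x mod 3 \<noteq> (y + 1) mod 3"
      using assms(3) by (simp add: mod_Suc)
    then have "\<not> slanted y z x" "\<not> slanted x y z"
      using assms(3) slanted_layers[of y z x] slanted_layers[of x y z] mod_3_neq[of x] by auto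
    then show ?thesis
      by (auto simp: collinear_def)
  qed
  show ?thesis
  proof (cases "[x = y] (mod n)")
    case True
    have "\<not> slanted z x y" for z
    proof
      assume s: "slanted z x y"
      then have "[z + x = 2 * y] (mod n)" by (simp add: slanted_def)
      also have "[2 * y = x + x] (mod n)"
        using True by (metis cong_scalar_left cong_sym mult_2)
      finally have "[z = x] (mod n)" by (simp add: cong_add_rcancel_nat)
      with s point_eqI[of z x] show False by (auto simp: slanted_def)
    qed
    moreover obtain z where z: "z < 3 * n" "z mod 3 = (x + 2) mod 3" "[z = x] (mod n)"
      using point_exists by blast
    have "x mod 3 \<noteq> y mod 3" "y mod 3 \<noteq> z mod 3" "x mod 3 \<noteq> z mod 3"
      using z(2) assms(3) by (auto simp: mod_Suc)
    then have "vertical x y z"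
      using assms True z by (auto simp: vertical_def intro: cong_sym cong_trans)
    moreover have "z' = z" if "vertical x y z'" for z'
    proof (rule point_eqI)
      show "z' mod 3 = z mod 3"
        using vertical_layers[OF that, of "z mod 3"] \<open>vertical x y z\<close> by (auto simp: vertical_def)
      show "[z' = z] (mod n)"
        using that \<open>vertical x y z\<close> by (simp add: vertical_def cong_def)
    qed (use that z in \<open>auto simp: vertical_def\<close>)
    ultimately show ?thesis
      using only by blast
  next
    case False
    then have not_vertical: "\<not> vertical x y z" for z
      by (simp add: vertical_def)
    \<comment> \<open>The summand \<open>(n - 1) * x\<close> represents \<open>- x\<close> modulo \<open>n\<close>.\<close>
    obtain z where z: "z < 3 * n" "z mod 3 = x mod 3" "[z = 2 * y + (n - 1) * x] (mod n)"
      using point_exists by blast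
    have "[z + x = (2 * y + (n - 1) * x) + x] (mod n)"
      using z(3) by (simp add: cong_add_rcancel_nat)
    also have "(2 * y + (n - 1) * x) + x = 2 * y + n * x"
      using n_pos by (cases n) auto
    also have "[\<dots> = 2 * y] (mod n)"
      by (simp add: cong_def)
    finally have sum: "[z + x = 2 * y] (mod n)" .
    have "z \<noteq> x"
      using sum False halve_cong[of x y] by (auto simp: mult_2)
    moreover have "y mod 3 = (z + 1) mod 3"
      using z(2) assms(3) by (simp add: mod_Suc)
    ultimately have "slanted z x y"
      using assms z sum by (simp add: slanted_def)
    moreover have "z' = z" if "slanted z' x y" for z'
    proof (rule point_eqI)
      have "[z' + x = z + x] (mod n)"
        using that sum by (simp add: slanted_def cong_def)
      then show "[z' = z] (mod n)"
        by (simp add: cong_add_rcancel_nat)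
    qed (use that z in \<open>auto simp: slanted_def\<close>)
    ultimately show ?thesis
      using only not_vertical by blast
  qed
qed

lemma third_point:
  assumes "x < 3 * n" "y < 3 * n" "x \<noteq> y"
  shows "\<exists>!z. collinear x y z"
proof -
  have "y mod 3 = x mod 3 \<or> y mod 3 = (x + 1) mod 3 \<or> x mod 3 = (y + 1) mod 3"
    by (auto simp: mod_Suc)
  then consider "y mod 3 = x mod 3" | "y mod 3 = (x + 1) mod 3" | "x mod 3 = (y + 1) mod 3"
    by blast
  then show ?thesis
  proof cases
    case 3
    with assms have "\<exists>!z. collinear y x z"
      by (intro third_point_next_layer)
    moreover have "collinear x y z \<longleftrightarrow> collinear y x z" for z
      using collinear_swap by blast
    ultimately show ?thesis
      by simp
  qed (use assms third_point_same_layer third_point_next_layer in auto)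
qed

lemma steiner_triple_system_triples: "steiner_triple_system (3 * n) {..<3 * n} triples"
  unfolding triples_def
proof (rule steiner_triple_system_of_collinearity)
  fix x y assume "x \<in> {..<3 * n}" "y \<in> {..<3 * n}" "x \<noteq> y"
  then show "\<exists>!z. collinear x y z"
    using third_point by simp
qed (simp_all, (use collinear_points collinear_distinct collinear_swap collinear_rot in blast)+)

lemma shift_less: "x < 3 * n \<Longrightarrow> shift x < 3 * n"
  using n_pos by (simp add: shift_def)

lemma shift_cong: "x < 3 * n \<Longrightarrow> [shift x = x + 1] (mod n)"
  and shift_mod_3: "x < 3 * n \<Longrightarrow> shift x mod 3 = (x + 1) mod 3"
  unfolding shift_def cong_def by (simp_all add: mod_mod_cancel)

lemma funpow_shift_0: "(shift ^^ k) 0 = k mod (3 * n)"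
  using n_pos by (induction k) (auto simp: shift_def mod_Suc_eq)

lemma inj_on_shift: "inj_on shift {..<3 * n}"
proof (rule inj_onI)
  fix x y assume xy: "x \<in> {..<3 * n}" "y \<in> {..<3 * n}" "shift x = shift y"
  then have "[x + 1 = y + 1] (mod (3 * n))"
    by (simp add: shift_def cong_def)
  then have "[x = y] (mod (3 * n))"
    by (simp only: cong_add_rcancel_nat)
  with xy show "x = y"
    by (simp add: cong_def)
qed

lemma shift_permutes: "shift permutes {..<3 * n}"
proof (rule bij_imp_permutes)
  have "shift ` {..<3 * n} = {..<3 * n}"
    using inj_on_shift shift_less by (intro endo_inj_surj) auto
  then show "bij_betw shift {..<3 * n} {..<3 * n}"
    using inj_on_shift by (simp add: bij_betw_def)
qed (simp add: shift_def)

lemma cyclic_on_shift: "cyclic_on shift {..<3 * n}"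
proof -
  have "orbit shift 0 = {..<3 * n}"
  proof (intro subset_antisym subsetI)
    fix x assume "x \<in> {..<3 * n}"
    \<comment> \<open>Orbits consist of positive iterates, so \<open>0\<close> itself is reached only after a full turn.\<close>
    then have "x = (shift ^^ (x + 3 * n)) 0" "0 < x + 3 * n"
      using n_pos by (simp_all only: funpow_shift_0) auto
    then show "x \<in> orbit shift 0"
      unfolding orbit_altdef by blast
  qed (use n_pos in \<open>auto simp: orbit_altdef funpow_shift_0\<close>)
  then show ?thesis
    using n_pos unfolding cyclic_on_def by force
qed

lemma shift_slanted:
  assumes "slanted x y z"
  shows "slanted (shift x) (shift y) (shift z)"
proof -
  have lt: "x < 3 * n" "y < 3 * n" "z < 3 * n" and ne: "x \<noteq> y"
    and layers: "y mod 3 = x mod 3" "z mod 3 = (x + 1) mod 3"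
    and mid: "[x + y = 2 * z] (mod n)"
    using assms by (auto simp: slanted_def)
  have "[shift x + shift y = (x + 1) + (y + 1)] (mod n)"
    using lt by (intro cong_add shift_cong)
  also have "(x + 1) + (y + 1) = (x + y) + 2"
    by simp
  also have "[\<dots> = 2 * z + 2] (mod n)"
    using mid by (simp only: cong_add_rcancel_nat)
  also have "2 * z + 2 = 2 * (z + 1)"
    by simp
  also have "[\<dots> = 2 * shift z] (mod n)"
    using lt by (intro cong_scalar_left cong_sym[OF shift_cong])
  finally have "[shift x + shift y = 2 * shift z] (mod n)" .
  moreover have "shift y mod 3 = shift x mod 3" "shift z mod 3 = (shift x + 1) mod 3"
    using layers shift_mod_3 lt by (simp_all add: mod_Suc)
  moreover have "shift x \<noteq> shift y"
    using inj_on_shift lt ne by (auto dest: inj_onD)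
  ultimately show ?thesis
    using lt shift_less by (simp add: slanted_def)
qed

lemma shift_vertical:
  assumes "vertical x y z"
  shows "vertical (shift x) (shift y) (shift z)"
proof -
  have lt: "x < 3 * n" "y < 3 * n" "z < 3 * n"
    and layers: "x mod 3 \<noteq> y mod 3" "y mod 3 \<noteq> z mod 3" "x mod 3 \<noteq> z mod 3"
    and same: "[x = y] (mod n)" "[y = z] (mod n)"
    using assms by (auto simp: vertical_def)
  have cong: "[shift a = shift b] (mod n)" if "a < 3 * n" "b < 3 * n" "[a = b] (mod n)" for a b
  proof -
    have "[a + 1 = b + 1] (mod n)"
      using that(3) by (simp only: cong_add_rcancel_nat)
    then show ?thesis
      using shift_cong that by (meson cong_sym cong_trans)
  qed
  have "shift x mod 3 \<noteq> shift y mod 3" "shift y mod 3 \<noteq> shift z mod 3" "shift x mod 3 \<noteq> shift z mod 3"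
    using layers shift_mod_3 lt by (auto simp: mod_Suc split: if_splits)
  with lt same cong shift_less show ?thesis
    by (simp add: vertical_def)
qed

lemma shift_collinear: "collinear x y z \<Longrightarrow> collinear (shift x) (shift y) (shift z)"
  using shift_vertical shift_slanted unfolding collinear_def by blast

lemma cyclic_steiner_triple_system_triples:
  "cyclic_steiner_triple_system (3 * n) {..<3 * n} triples"
proof -
  have "(\<lambda>T. shift ` T) ` triples = triples"
  proof (rule endo_inj_surj)
    show "finite triples"
      using card_triples_of_steiner_triple_system(1)[OF steiner_triple_system_triples] .
    show "(\<lambda>T. shift ` T) ` triples \<subseteq> triples"
      using shift_collinear by (force simp: triples_def)
    show "inj_on (\<lambda>T. shift ` T) triples"
      using permutes_inj[OF shift_permutes] by (auto intro!: inj_onI simp: inj_image_eq_iff)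
  qed
  then show ?thesis
    using steiner_triple_system_triples shift_permutes cyclic_on_shift
    unfolding cyclic_steiner_triple_system_def sts_automorphism_def by blast
qed

section \<open>Vertical triples in parallel classes\<close>

lemma vertical_triples_subset: "vertical_triples \<subseteq> triples"
  unfolding vertical_triples_def triples_def collinear_def by blast

text \<open>
  A vertical triple is a whole residue class modulo \<open>n\<close>.
\<close>

lemma card_vertical_triples_le: "card vertical_triples \<le> n"
proof -
  have "vertical_triples \<subseteq> (\<lambda>r. {w. w < 3 * n \<and> w mod n = r}) ` {..<n}"
  proof
    fix T assume "T \<in> vertical_triples"
    then obtain x y z where T: "T = {x, y, z}" and v: "vertical x y z"
      by (auto simp: vertical_triples_def)
    have "w \<in> T" if w: "w < 3 * n" "w mod n = x mod n" for w
    proof -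
      have "w mod 3 = x mod 3 \<or> w mod 3 = y mod 3 \<or> w mod 3 = z mod 3"
        using vertical_layers[OF v, of "w mod 3"] by simp
      then have "w = x \<or> w = y \<or> w = z"
        using w v point_eqI[of w x] point_eqI[of w y] point_eqI[of w z]
        unfolding vertical_def cong_def by metis
      then show ?thesis
        using T by blast
    qed
    then have "T = {w. w < 3 * n \<and> w mod n = x mod n}"
      using T v by (auto simp: vertical_def cong_def)
    then show "T \<in> (\<lambda>r. {w. w < 3 * n \<and> w mod n = r}) ` {..<n}"
      using n_pos by auto
  qed
  then have "card vertical_triples \<le> card {..<n}"
    by (rule surj_card_le[rotated]) simp
  then show ?thesis
    by simp
qed

definition layer :: "nat \<Rightarrow> nat set" where
  "layer i = {x. x < 3 * n \<and> x mod 3 = i}"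

lemma card_layer:
  assumes "i < 3"
  shows "card (layer i) = n"
proof -
  have "layer i = (\<lambda>k. 3 * k + i) ` {..<n}"
  proof (intro subset_antisym subsetI)
    fix x assume "x \<in> layer i"
    then have "x = 3 * (x div 3) + i" "x div 3 < n"
      by (auto simp: layer_def)
    then show "x \<in> (\<lambda>k. 3 * k + i) ` {..<n}"
      by blast
  qed (use assms in \<open>auto simp: layer_def\<close>)
  then show ?thesis
    by (simp add: card_image inj_on_def)
qed

lemma card_inter_layer_slanted:
  assumes "slanted x y z" and "i < 3"
  shows "card ({x, y, z} \<inter> layer i) =
    (if x mod 3 = i then 2 else if (x + 1) mod 3 = i then 1 else 0)"
proof -
  have "x mod 3 \<noteq> (x + 1) mod 3"
    by (rule mod_3_neq)
  with assms show ?thesis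
    by (auto simp: slanted_def layer_def Int_insert_left)
qed

lemma card_inter_layer_vertical:
  assumes "T \<in> vertical_triples" and "i < 3"
  shows "card (T \<inter> layer i) = 1"
proof -
  obtain x y z where T: "T = {x, y, z}" and v: "vertical x y z"
    using assms(1) by (auto simp: vertical_triples_def)
  have "x mod 3 = i \<or> y mod 3 = i \<or> z mod 3 = i"
    using vertical_layers[OF v assms(2)] by blast
  with v show ?thesis
    unfolding T by (auto simp: vertical_def layer_def Int_insert_left)
qed

lemma triple_cases:
  assumes "T \<in> triples"
  obtains "T \<in> vertical_triples" | x y z where "T = {x, y, z}" "slanted x y z"
proof -
  from assms obtain x y z where "T = {x, y, z}" "collinear x y z"
    by (auto simp: triples_def)
  then show thesis
    using that unfolding collinear_def vertical_triples_def by (smt (verit) insert_commute mem_Collect_eq)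
qed

text \<open>
  The differences of the three equations give \<open>a0 = a1 = a2\<close>, hence \<open>m = b + 3 a0\<close>.
\<close>

lemma layer_balance:
  fixes m b :: nat
  assumes "m = b + 2 * a0 + a2" "m = b + 2 * a1 + a0" "m = b + 2 * a2 + a1"
    and "m mod 3 = 2"
  shows "2 \<le> b"
proof -
  have "m = b + 3 * a0"
    using assms(1-3) by linarith
  then show ?thesis
    using assms(4) by presburger
qed

text \<open>
  The points of a layer are counted through the triples of the class. This is where
  \<open>n \<equiv> 2 (mod 3)\<close> matters: it makes the number of vertical triples congruent to \<open>2\<close>.
\<close>

lemma parallel_class_two_verticals:
  assumes "partial_parallel_class triples C" and "\<Union>C = {..<3 * n}"
  shows "2 \<le> card (C \<inter> vertical_triples)"
proof -
  \<comment> \<open>The slanted triples of \<open>C\<close> based in layer \<open>j\<close>: no other triple has two points there.\<close>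
  define A where "A j = {T \<in> C. card (T \<inter> layer j) = 2}" for j
  have A_subset: "A j \<subseteq> C" for j
    by (auto simp: A_def)
  have sub: "C \<subseteq> triples" and dis: "disjoint C"
    using assms(1) by (auto simp: partial_parallel_class_def)
  have fin: "finite C"
    using card_triples_of_steiner_triple_system(1)[OF steiner_triple_system_triples] sub
    by (rule finite_subset[rotated])
  \<comment> \<open>Layer \<open>i\<close> is met once by the slanted triples based in the preceding layer, \<open>(i + 2) mod 3\<close>.\<close>
  have profile: "card (T \<inter> layer i) = of_bool (T \<in> vertical_triples)
      + 2 * of_bool (T \<in> A i) + of_bool (T \<in> A ((i + 2) mod 3))"
    if "T \<in> C" "i < 3" for T i
    using subsetD[OF sub that(1)]
  proof (cases rule: triple_cases)
    case 1
    then show ?thesis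
      using card_inter_layer_vertical that(2) by (simp add: A_def)
  next
    case (2 x y z)
    have card_T: "card (T \<inter> layer j) =
        (if x mod 3 = j then 2 else if (x + 1) mod 3 = j then 1 else 0)" if "j < 3" for j
      unfolding 2(1) by (rule card_inter_layer_slanted[OF 2(2) that])
    have "T \<notin> vertical_triples"
      using card_inter_layer_vertical[of T "x mod 3"] card_T[of "x mod 3"] by auto
    moreover have "T \<in> A j \<longleftrightarrow> x mod 3 = j" if "j < 3" for j
      using card_T[OF that] \<open>T \<in> C\<close> by (simp add: A_def)
    then have "T \<in> A i \<longleftrightarrow> x mod 3 = i" "T \<in> A ((i + 2) mod 3) \<longleftrightarrow> x mod 3 = (i + 2) mod 3"
      using \<open>i < 3\<close> by simp_all
    moreover have "(x + 1) mod 3 = i \<longleftrightarrow> x mod 3 = (i + 2) mod 3"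
      using \<open>i < 3\<close> by (auto simp: mod_Suc split: if_splits)
    moreover have "i \<noteq> (i + 2) mod 3"
      using \<open>i < 3\<close> by (auto simp: mod_Suc split: if_splits)
    ultimately show ?thesis
      using card_T[OF \<open>i < 3\<close>] by simp
  qed
  have count: "n = card (C \<inter> vertical_triples) + 2 * card (A i) + card (A j)"
    if "i < 3" and j: "j = (i + 2) mod 3" for i j
  proof -
    have "n = card (layer i)"
      using card_layer[OF \<open>i < 3\<close>] by simp
    also have "layer i = (\<Union>T\<in>C. T \<inter> layer i)"
      using assms(2) by (auto simp: layer_def)
    also have "card \<dots> = (\<Sum>T\<in>C. card (T \<inter> layer i))"
      by (rule card_UN_disjoint) (use fin dis in \<open>auto simp: disjoint_def layer_def\<close>)
    also have "\<dots> = (\<Sum>T\<in>C. of_bool (T \<in> vertical_triples)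
        + 2 * of_bool (T \<in> A i) + of_bool (T \<in> A j))"
      unfolding j using profile \<open>i < 3\<close> by (intro sum.cong) auto
    also have "\<dots> = card (C \<inter> vertical_triples) + 2 * card (C \<inter> A i) + card (C \<inter> A j)"
      using fin by (simp add: sum.distrib sum_distrib_left[symmetric] Int_def)
    finally show ?thesis
      by (simp add: Int_absorb1 A_subset)
  qed
  show ?thesis
    by (rule layer_balance[OF count[of 0 2] count[of 1 0] count[of 2 1] n_mod_3]) simp_all
qed

lemma chromatic_index_triples: "3 * n + 3 \<le> 2 * chromatic_index triples"
proof -
  have "3 * n + 1 < 2 * chromatic_index triples"
    using steiner_triple_system_triples n_pos vertical_triples_subset card_vertical_triples_le
      parallel_class_two_verticals
    by (rule chromatic_index_lower_bound)
  moreover have "even (3 * n + 1)"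
    using odd_n by simp
  moreover have "a + 2 \<le> 2 * c" if "a < 2 * c" "even a" for a c :: nat
    using that by presburger
  ultimately have "3 * n + 1 + 2 \<le> 2 * chromatic_index triples"
    by blast
  then show ?thesis
    by simp
qed

end

theorem theorem4:
  fixes v :: nat
  assumes "v > 0" and "[v = 15] (mod 18)"
  shows "\<exists>(V :: nat set) \<B>. cyclic_steiner_triple_system v V \<B> \<and>
           real (chromatic_index \<B>) \<ge> (real v + 3) / 2"
proof -
  have "v mod 18 = 15"
    using assms(2) by (simp add: cong_def)
  then obtain k where k: "v = 18 * k + 15"
    using mult_div_mod_eq[of 18 v] by metis
  define n where "n = 6 * k + 5"
  have v: "v = 3 * n" and n: "n mod 6 = 5"
    using k by (simp_all add: n_def)
  interpret bose n
    by standard (fact n)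
  have "v + 3 \<le> 2 * chromatic_index triples"
    using chromatic_index_triples by (simp only: v)
  then have "real (v + 3) \<le> real (2 * chromatic_index triples)"
    by (rule of_nat_mono)
  then have "(real v + 3) / 2 \<le> real (chromatic_index triples)"
    by simp
  then show ?thesis
    using cyclic_steiner_triple_system_triples v by blast
qed

end
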